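(* Let $k\ge 2$ be an integer and let $G$ be a fixed graph with $\chi(G)\ge 2$. For every fixed $\epsilon>0$ there exists $n_0$ such that for all $n\ge n_0$, $$\hat{\mathrm{ex}}_k(n,G)\le\left(1-\frac{1}{\chi(G)-1}+\epsilon\right)\binom{n}{2}.$$
   Context: A $k$-graph is a hypergraph all of whose edges have exactly $k$ vertices. The shadow $\partial(\mathcal{H})$ of a hypergraph $\mathcal{H}$ is the simple graph on $V(\mathcal{H})$ in which $uv$ is an edge iff $\{u,v\}\subseteq h$ for some edge $h$ of $\mathcal{H}$. For a simple graph $G$, a hypergraph $\mathcal{H}$ is a Berge-$G$ if there is an injection $i:V(G)\to V(\mathcal{H})$ and a bijection $f:E(G)\to E(\mathcal{H})$ with $\{i(u),i(v)\}\subseteq f(uv)$ for every $uv\in E(G)$; $\mathcal{H}$ is Berge-$G$-free if no subhypergraph of it is a Berge-$G$. $\hat{\mathrm{ex}}_k(n,G)$ is the maximum number of edges of $\partial(\mathcal{H})$ over all Berge-$G$-free $k$-graphs $\mathcal{H}$ on $n$ vertices. $\chi(G)$ is the chromatic number. *)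

theory Defs
  imports Complex_Main
begin

record 'a hypergraph =
  verts :: "'a set"
  edges :: "'a set set"

definition is_hypergraph :: "'a hypergraph \<Rightarrow> bool" where
  "is_hypergraph H \<longleftrightarrow> finite (verts H) \<and> (\<forall>h\<in>edges H. h \<subseteq> verts H)"

definition k_graph :: "nat \<Rightarrow> 'a hypergraph \<Rightarrow> bool" where
  "k_graph k H \<longleftrightarrow> is_hypergraph H \<and> (\<forall>h\<in>edges H. card h = k)"

abbreviation simple_graph :: "'a hypergraph \<Rightarrow> bool" where
  "simple_graph G \<equiv> k_graph 2 G"

definition subhypergraph :: "'a hypergraph \<Rightarrow> 'a hypergraph \<Rightarrow> bool" where
  "subhypergraph H' H \<longleftrightarrow>
     is_hypergraph H' \<and> verts H' \<subseteq> verts H \<and> edges H' \<subseteq> edges H"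

definition shadow :: "'a hypergraph \<Rightarrow> 'a hypergraph" where
  "shadow H =
     \<lparr>verts = verts H,
      edges = {{u, v} | u v. u \<noteq> v \<and> (\<exists>h\<in>edges H. {u, v} \<subseteq> h)}\<rparr>"

definition is_Berge :: "'a hypergraph \<Rightarrow> 'b hypergraph \<Rightarrow> bool" where
  "is_Berge G H \<longleftrightarrow>
     (\<exists>i f. inj_on i (verts G) \<and> i ` verts G \<subseteq> verts H \<and>
            bij_betw f (edges G) (edges H) \<and>
            (\<forall>u v. {u, v} \<in> edges G \<longrightarrow> {i u, i v} \<subseteq> f {u, v}))"

definition Berge_free :: "'a hypergraph \<Rightarrow> 'b hypergraph \<Rightarrow> bool" where
  "Berge_free G H \<longleftrightarrow> \<not> (\<exists>H'. subhypergraph H' H \<and> is_Berge G H')"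

definition proper_coloring :: "'a hypergraph \<Rightarrow> nat \<Rightarrow> ('a \<Rightarrow> nat) \<Rightarrow> bool" where
  "proper_coloring G c col \<longleftrightarrow>
     col ` verts G \<subseteq> {..<c} \<and> (\<forall>u v. {u, v} \<in> edges G \<longrightarrow> col u \<noteq> col v)"

definition chromatic_number :: "'a hypergraph \<Rightarrow> nat" where
  "chromatic_number G = (LEAST c. \<exists>col. proper_coloring G c col)"

text \<open>Up to isomorphism, every finite hypergraph has its vertices in \<^typ>\<open>nat\<close>.\<close>

definition shadow_sizes :: "nat \<Rightarrow> nat \<Rightarrow> 'a hypergraph \<Rightarrow> nat set" where
  "shadow_sizes k n G =
     {card (edges (shadow H)) | H :: nat hypergraph.
        k_graph k H \<and> card (verts H) = n \<and> Berge_free G H}"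

definition ex_hat :: "nat \<Rightarrow> nat \<Rightarrow> 'a hypergraph \<Rightarrow> nat" where
  "ex_hat k n G = Max (shadow_sizes k n G)"

text \<open>\<^const>\<open>Max\<close> is meaningful here: the set is finite, and nonempty as soon as \<open>G\<close> has an
  edge, which \<open>chromatic_number G \<ge> 2\<close> guarantees.\<close>

lemma finite_shadow_sizes: "finite (shadow_sizes k n G)"
proof -
  have "card (edges (shadow H)) \<le> 2 ^ n"
    if "k_graph k H" "card (verts H) = n" for H :: "nat hypergraph"
  proof -
    have fin: "finite (verts H)" and sub: "\<forall>h\<in>edges H. h \<subseteq> verts H"
      using that(1) by (auto simp: k_graph_def is_hypergraph_def)
    have "edges (shadow H) \<subseteq> Pow (verts H)"
      using sub unfolding shadow_def by fastforce
    then have "card (edges (shadow H)) \<le> card (Pow (verts H))"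
      using fin by (intro card_mono) auto
    then show ?thesis
      using that(2) fin by (simp add: card_Pow)
  qed
  then have "shadow_sizes k n G \<subseteq> {..2 ^ n}"
    unfolding shadow_sizes_def by auto
  then show ?thesis
    by (rule finite_subset) simp
qed

lemma shadow_sizes_nonempty:
  assumes "edges G \<noteq> {}"
  shows "shadow_sizes k n G \<noteq> {}"
proof -
  let ?H = "\<lparr>verts = {..<n}, edges = {}\<rparr> :: nat hypergraph"
  have "Berge_free G ?H"
    using assms by (auto simp: Berge_free_def subhypergraph_def is_Berge_def bij_betw_def)
  moreover have "k_graph k ?H" "card (verts ?H) = n"
    by (auto simp: k_graph_def is_hypergraph_def)
  ultimately show ?thesis
    unfolding shadow_sizes_def by blast
qed

lemma chromatic_number_ge_2_imp_edges:
  assumes "chromatic_number G \<ge> 2"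
  shows "edges G \<noteq> {}"
proof
  assume "edges G = {}"
  then have "proper_coloring G 1 (\<lambda>_. 0)"
    by (auto simp: proper_coloring_def)
  then have "chromatic_number G \<le> 1"
    unfolding chromatic_number_def by (intro Least_le) blast
  then show False
    using assms by simp
qed

end

theory Submission
  imports Defs "HOL-Library.FuncSet"
begin

text \<open>
  The bound is the Erdos--Stone theorem applied to the shadow. A shadow that is too dense
  contains a subgraph of large minimum degree, hence, adding one part at a time by pigeonhole, a
  complete \<open>\<chi>(G)\<close>-partite graph with parts of any prescribed size \<open>T\<close>. Fix for every shadow edge
  one hyperedge containing it. Map the vertices of \<open>G\<close> into the parts according to a proper
  colouring. For a vertex \<open>w\<close>, only a bounded number of images is forbidden by the images of the
  other vertices: those images themselves, and the members of the hyperedges assigned to the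
  edges of \<open>G\<close> avoiding \<open>w\<close>. So for large \<open>T\<close> the proportion of bad maps is less than one, and
  any good map gives a Berge copy of \<open>G\<close>: two edges \<open>e \<noteq> e'\<close> of \<open>G\<close> receive distinct hyperedges,
  because a vertex of \<open>e' - e\<close> avoids the hyperedge of \<open>e\<close>.
\<close>

section \<open>Subgraphs of large minimum degree\<close>

text \<open>Every edge is the image of an ordered pair of its ends. This crude bound later turns
  many edges inside \<open>S\<close> into many vertices of \<open>S\<close>.\<close>

lemma edges_within_le_square:
  assumes "finite S" and "\<And>e. e \<in> D \<Longrightarrow> card e = 2"
  shows "card {e \<in> D. e \<subseteq> S} \<le> (card S)\<^sup>2"
proof -
  have "{e \<in> D. e \<subseteq> S} \<subseteq> (\<lambda>(x, y). {x, y}) ` (S \<times> S)"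
  proof
    fix e assume e: "e \<in> {e \<in> D. e \<subseteq> S}"
    then have "card e = 2" using assms(2) by blast
    then obtain x y where "e = {x, y}" by (auto simp: card_2_iff)
    with e show "e \<in> (\<lambda>(x, y). {x, y}) ` (S \<times> S)" by auto
  qed
  then have "card {e \<in> D. e \<subseteq> S} \<le> card ((\<lambda>(x, y). {x, y}) ` (S \<times> S))"
    using assms(1) by (intro card_mono) auto
  also have "\<dots> \<le> card (S \<times> S)" using assms(1) by (intro card_image_le) auto
  finally show ?thesis by (simp add: card_cartesian_product power2_eq_square)
qed

text \<open>Edges through \<open>v\<close> are counted by the neighbours of \<open>v\<close>. This
  controls how deleting one vertex changes an edge count in the extremal choice below.\<close>

lemma edges_within_remove_vertex:
  assumes "finite S" and "v \<in> S" and "\<And>e. e \<in> D \<Longrightarrow> card e = 2"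
  shows "card {e \<in> D. e \<subseteq> S} \<le> card {e \<in> D. e \<subseteq> S - {v}} + card {u \<in> S. {u, v} \<in> D}"
proof -
  have "{e \<in> D. e \<subseteq> S} \<subseteq> {e \<in> D. e \<subseteq> S - {v}} \<union> (\<lambda>u. {u, v}) ` {u \<in> S. {u, v} \<in> D}"
  proof
    fix e assume e: "e \<in> {e \<in> D. e \<subseteq> S}"
    then have "card e = 2" using assms(3) by blast
    then obtain x y where xy: "e = {x, y}" by (auto simp: card_2_iff)
    show "e \<in> {e \<in> D. e \<subseteq> S - {v}} \<union> (\<lambda>u. {u, v}) ` {u \<in> S. {u, v} \<in> D}"
    proof (cases "v \<in> e")
      case True
      then obtain u where "e = {u, v}" using xy by blast
      with e show ?thesis by auto
    qed (use e in auto)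
  qed
  then have "card {e \<in> D. e \<subseteq> S}
      \<le> card ({e \<in> D. e \<subseteq> S - {v}} \<union> (\<lambda>u. {u, v}) ` {u \<in> S. {u, v} \<in> D})"
    using assms(1) by (intro card_mono) (auto intro: finite_subset[of _ "Pow S"])
  also have "\<dots> \<le> card {e \<in> D. e \<subseteq> S - {v}} + card ((\<lambda>u. {u, v}) ` {u \<in> S. {u, v} \<in> D})"
    by (rule card_Un_le)
  also have "card ((\<lambda>u. {u, v}) ` {u \<in> S. {u, v} \<in> D}) \<le> card {u \<in> S. {u, v} \<in> D}"
    using assms(1) by (intro card_image_le) auto
  finally show ?thesis by simp
qed

text \<open>
  Take \<open>S\<close> to maximise the potential \<open>e(S) - a \<cdot> card S \<cdot> (card S + 1) / 2\<close>: removing a vertex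
  lowers the subtracted term by exactly \<open>a \<cdot> card S\<close>.
\<close>

lemma large_min_degree_subset:
  fixes a :: real
  assumes "finite V" and "\<And>e. e \<in> D \<Longrightarrow> card e = 2"
  obtains S where "S \<subseteq> V"
    and "\<And>v. v \<in> S \<Longrightarrow> a * real (card S) \<le> real (card {u \<in> S. {u, v} \<in> D})"
    and "real (card {e \<in> D. e \<subseteq> V}) - a * (real (card V) * (real (card V) + 1) / 2)
      \<le> real (card {e \<in> D. e \<subseteq> S}) - a * (real (card S) * (real (card S) + 1) / 2)"
proof -
  define p where "p S = real (card {e \<in> D. e \<subseteq> S}) - a * (real (card S) * (real (card S) + 1) / 2)"
    for S
  have fin: "finite (p ` Pow V)" and ne: "p ` Pow V \<noteq> {}" using assms(1) by auto
  obtain S where S: "S \<subseteq> V" "p S = Max (p ` Pow V)"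
    using Max_in[OF fin ne] by auto
  have max: "p S' \<le> p S" if "S' \<subseteq> V" for S'
    using S(2) that fin by simp
  have finS: "finite S" using S(1) assms(1) finite_subset by auto
  have "a * real (card S) \<le> real (card {u \<in> S. {u, v} \<in> D})" if v: "v \<in> S" for v
  proof -
    have "card S \<ge> 1" using v finS by (metis One_nat_def Suc_leI card_gt_0_iff empty_iff)
    moreover have "card (S - {v}) = card S - 1" using v finS by simp
    ultimately have y: "real (card (S - {v})) = real (card S) - 1" by simp
    have "a * (real (card S) * (real (card S) + 1) / 2)
        = a * (real (card (S - {v})) * (real (card (S - {v})) + 1) / 2) + a * real (card S)"
      unfolding y by (simp add: field_simps)
    moreover have "p (S - {v}) \<le> p S" using S(1) by (intro max) auto
    moreover have "real (card {e \<in> D. e \<subseteq> S})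
        \<le> real (card {e \<in> D. e \<subseteq> S - {v}}) + real (card {u \<in> S. {u, v} \<in> D})"
      using edges_within_remove_vertex[OF finS v assms(2), of D] by linarith
    ultimately show ?thesis unfolding p_def by linarith
  qed
  with S(1) max[of V] show ?thesis by (intro that[of S]) (auto simp: p_def)
qed

section \<open>The Erdos--Stone theorem\<close>

text \<open>The parts are automatically disjoint when all members of \<open>D\<close> have two elements.\<close>

definition complete_multipartite :: "'a set set \<Rightarrow> 'a set \<Rightarrow> nat \<Rightarrow> nat \<Rightarrow> (nat \<Rightarrow> 'a set) \<Rightarrow> bool" where
  "complete_multipartite D V s t A \<longleftrightarrow>
     (\<forall>i<s. A i \<subseteq> V \<and> finite (A i) \<and> card (A i) = t) \<and>
     (\<forall>i<s. \<forall>j<s. i \<noteq> j \<longrightarrow> (\<forall>x\<in>A i. \<forall>y\<in>A j. {x, y} \<in> D))"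

text \<open>Each \<open>w\<close> in \<open>W\<close> selects \<open>t\<close> of its neighbours in
  every part. There are at most \<open>(2 ^ T) ^ s\<close> selections, so by pigeonhole
  \<open>t\<close> vertices of \<open>W\<close> make the same one. These vertices form the new part,
  and their common selection shrinks the old parts from size \<open>T\<close> to
  \<open>t\<close>.\<close>

lemma complete_multipartite_extend:
  fixes A :: "nat \<Rightarrow> 'a set"
  assumes A: "complete_multipartite D V s T A"
    and W: "finite W" "W \<subseteq> V" "(2 ^ T) ^ s * t < card W"
    and nbrs: "\<And>w i. w \<in> W \<Longrightarrow> i < s \<Longrightarrow> t \<le> card {u \<in> A i. {u, w} \<in> D}"
  shows "\<exists>B. complete_multipartite D V (Suc s) t B"
proof -
  have finA: "finite (A i)" and cardA: "card (A i) = T" and AV: "A i \<subseteq> V" if "i < s" for i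
    using A that by (auto simp: complete_multipartite_def)
  have "\<exists>X. X \<subseteq> {u \<in> A i. {u, w} \<in> D} \<and> card X = t" if "w \<in> W" "i < s" for w i
    using obtain_subset_with_card_n[OF nbrs[OF that]] by metis
  then obtain g where g: "\<And>w i. w \<in> W \<Longrightarrow> i < s \<Longrightarrow>
      g w i \<subseteq> {u \<in> A i. {u, w} \<in> D} \<and> card (g w i) = t"
    by metis
  \<comment> \<open>All tuples of subsets are counted, not only those of size \<open>t\<close>,
    which gives the factor \<open>(2 ^ T) ^ s\<close>. Restricting \<open>g w\<close> to the indices
    below \<open>s\<close> places it in this finite product.\<close>
  define P where "P = (\<Pi>\<^sub>E i\<in>{..<s}. Pow (A i))"
  define f where "f w = restrict (g w) {..<s}" for w
  have finP: "finite P" unfolding P_def using finA by (intro finite_PiE) auto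
  have "card P = (\<Prod>i<s. 2 ^ T)"
    unfolding P_def using finA cardA by (simp add: card_PiE card_Pow)
  then have cardP: "card P = (2 ^ T) ^ s" by simp
  have fP: "f w \<in> P" if "w \<in> W" for w
    using g[OF that] by (fastforce simp: f_def P_def)
  have "\<exists>b\<in>P. t \<le> card {w \<in> W. f w = b}"
  proof (rule ccontr)
    assume "\<not> ?thesis"
    then have small: "card {w \<in> W. f w = b} \<le> t" if "b \<in> P" for b
      using that by force
    have "W = (\<Union>b\<in>P. {w \<in> W. f w = b})" using fP by auto
    then have "card W \<le> (\<Sum>b\<in>P. card {w \<in> W. f w = b})"
      using card_UN_le[OF finP, of "\<lambda>b. {w \<in> W. f w = b}"] by simp
    also have "\<dots> \<le> card P * t" using sum_bounded_above[of P _ t] small by fastforce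
    finally show False using W(3) cardP by simp
  qed
  then obtain b where "t \<le> card {w \<in> W. f w = b}" by blast
  then obtain X where X: "X \<subseteq> {w \<in> W. f w = b}" "card X = t" "finite X"
    by (rule obtain_subset_with_card_n)
  show ?thesis
  \<comment> \<open>For \<open>t = 0\<close> the set \<open>X\<close> is empty and offers no
    \<open>w\<close> from which to read off the common selection.\<close>
  proof (cases "t = 0")
    case True
    then show ?thesis
      by (intro exI[of _ "\<lambda>_. {}"]) (simp add: complete_multipartite_def)
  next
    case False
    then obtain w where w: "w \<in> X" using X(2) by fastforce
    define B where "B i = (if i = s then X else g w i)" for i
    have gX: "g x i = g w i" if "x \<in> X" "i < s" for x i
    proof -
      have "f x = f w" using that(1) w X(1) by auto
      then have "f x i = f w i" by simp
      with that(2) show ?thesis by (simp add: f_def)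
    qed
    have gw: "g w i \<subseteq> A i" "card (g w i) = t" if "i < s" for i
      using g[of w i] w X(1) that by auto
    have BX: "{x, y} \<in> D" if "x \<in> g w i" "y \<in> X" "i < s" for x y i
      using g[of y i] gX[of y i] that X(1) by auto
    have BX': "{y, x} \<in> D" if "x \<in> g w i" "y \<in> X" "i < s" for x y i
      using BX[OF that] by (simp add: insert_commute)
    have BB: "{x, y} \<in> D" if "x \<in> g w i" "y \<in> g w j" "i < s" "j < s" "i \<noteq> j" for x y i j
      using A that gw(1) unfolding complete_multipartite_def by blast
    have "complete_multipartite D V (Suc s) t B"
      unfolding complete_multipartite_def
    proof (intro conjI allI impI ballI)
      fix i assume i: "i < Suc s"
      show "B i \<subseteq> V" "finite (B i)" "card (B i) = t"
        using i X W(2) gw[of i] AV[of i] finA[of i] finite_subset[of "g w i" "A i"]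
        by (auto simp: B_def less_Suc_eq)
    next
      fix i j x y assume "i < Suc s" "j < Suc s" "i \<noteq> j" "x \<in> B i" "y \<in> B j"
      then show "{x, y} \<in> D"
        using BX BX' BB by (auto simp: B_def less_Suc_eq split: if_splits)
    qed
    then show ?thesis by blast
  qed
qed

text \<open>Count the adjacent pairs between \<open>V\<close> and the parts twice. The degree
  condition at the vertices of the parts bounds the count from below. From above, a vertex of
  \<open>W\<close>, the set being measured, contributes at most \<open>s * T\<close>, and any other
  vertex at most \<open>(s - 1) * T + t\<close>. A small \<open>W\<close> would make the upper bound
  too small.\<close>

lemma many_common_neighbours:
  fixes \<epsilon> :: real
  assumes A: "complete_multipartite D V s T A" and fin: "finite V" and s: "s \<ge> 1" and T: "T > 0"
    and tT: "2 * real t \<le> \<epsilon> * real T"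
    and deg: "\<And>v. v \<in> V \<Longrightarrow>
      (1 - 1 / real s + \<epsilon>) * real (card V) \<le> real (card {u \<in> V. {u, v} \<in> D})"
  shows "\<epsilon> / 2 * real (card V)
    \<le> real (card {v \<in> V. \<forall>i<s. t \<le> card {u \<in> A i. {u, v} \<in> D}})"
proof -
  define N where "N v i = card {u \<in> A i. {u, v} \<in> D}" for v i
  define W where "W = {v \<in> V. \<forall>i<s. t \<le> N v i}"
  have finA: "finite (A i)" and cardA: "card (A i) = T" and AV: "A i \<subseteq> V" if "i < s" for i
    using A that by (auto simp: complete_multipartite_def)
  have finW: "finite W" using fin by (simp add: W_def)
  have N_le: "N v i \<le> T" if "i < s" for v i
    using card_mono[OF finA[OF that], of "{u \<in> A i. {u, v} \<in> D}"] cardA[OF that]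
    by (auto simp: N_def)
  have swap: "(\<Sum>u\<in>A i. card {v \<in> V. {v, u} \<in> D}) = (\<Sum>v\<in>V. N v i)" if "i < s" for i
    unfolding N_def
    using sum.swap_restrict[OF finA[OF that] fin, of "\<lambda>_ _. 1::nat" "\<lambda>u v. {u, v} \<in> D"]
    by (simp add: insert_commute)
  have "real T * ((1 - 1 / real s + \<epsilon>) * real (card V)) \<le> real (\<Sum>v\<in>V. N v i)" if i: "i < s" for i
  proof -
    have "real (card (A i)) * ((1 - 1 / real s + \<epsilon>) * real (card V))
        \<le> (\<Sum>u\<in>A i. real (card {v \<in> V. {v, u} \<in> D}))"
      using AV[OF i] by (intro sum_bounded_below deg) auto
    also have "\<dots> = real (\<Sum>v\<in>V. N v i)" by (simp only: of_nat_sum[symmetric] swap[OF i])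
    finally show ?thesis by (simp only: cardA[OF i])
  qed
  then have "real (card {..<s}) * (real T * ((1 - 1 / real s + \<epsilon>) * real (card V)))
      \<le> (\<Sum>i<s. real (\<Sum>v\<in>V. N v i))"
    by (intro sum_bounded_below) auto
  also have "\<dots> = real (\<Sum>v\<in>V. \<Sum>i<s. N v i)" by (subst sum.swap) simp
  finally have lower: "real s * (real T * ((1 - 1 / real s + \<epsilon>) * real (card V)))
      \<le> real (\<Sum>v\<in>V. \<Sum>i<s. N v i)" by simp
  have vW: "(\<Sum>i<s. N v i) \<le> s * T" for v
    using sum_bounded_above[of "{..<s}" "N v" T] N_le by simp
  \<comment> \<open>Such a vertex has fewer than \<open>t\<close> neighbours in some part
    \<open>i\<close> and at most \<open>T\<close> in each of the other \<open>s - 1\<close>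
    parts.\<close>
  have vnW: "(\<Sum>i<s. N v i) \<le> (s - 1) * T + t" if v: "v \<in> V - W" for v
  proof -
    obtain i where i: "i < s" "N v i < t" using v by (auto simp: W_def not_le)
    have "(\<Sum>i<s. N v i) = N v i + (\<Sum>j\<in>{..<s} - {i}. N v j)"
      using i(1) by (subst sum.remove[of _ i]) auto
    also have "(\<Sum>j\<in>{..<s} - {i}. N v j) \<le> card ({..<s} - {i}) * T"
      using sum_bounded_above[of "{..<s} - {i}" "N v" T] N_le by simp
    finally show ?thesis using i by simp
  qed
  have "(\<Sum>v\<in>V. \<Sum>i<s. N v i) = (\<Sum>v\<in>W. \<Sum>i<s. N v i) + (\<Sum>v\<in>V - W. \<Sum>i<s. N v i)"
    using fin by (subst sum.subset_diff[of W]) (auto simp: W_def)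
  also have "\<dots> \<le> card W * (s * T) + card (V - W) * ((s - 1) * T + t)"
    using sum_bounded_above[of W "\<lambda>v. \<Sum>i<s. N v i" "s * T"]
      sum_bounded_above[of "V - W" "\<lambda>v. \<Sum>i<s. N v i" "(s - 1) * T + t"] vW vnW
    by (intro add_mono) auto
  also have "\<dots> \<le> card W * (s * T) + card V * ((s - 1) * T + t)"
    using card_mono[OF fin, of "V - W"] by (intro add_mono mult_right_mono) auto
  finally have "real (\<Sum>v\<in>V. \<Sum>i<s. N v i) \<le> real (card W * (s * T) + card V * ((s - 1) * T + t))"
    by (rule of_nat_mono)
  then have upper: "real (\<Sum>v\<in>V. \<Sum>i<s. N v i)
      \<le> real (card W) * (real s * real T) + real (card V) * ((real s - 1) * real T + real t)"
    using s by (simp add: of_nat_diff)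
  \<comment> \<open>Since \<open>s * (1 - 1 / s) = s - 1\<close>, the main term cancels against the
    one in \<open>upper\<close>, and only the \<epsilon> surplus remains.\<close>
  have "real s * (real T * ((1 - 1 / real s + \<epsilon>) * real (card V)))
      = real (card V) * ((real s - 1) * real T + \<epsilon> * (real s * real T))"
    using s by (simp add: field_simps)
  with lower upper have "real (card V) * (\<epsilon> * (real s * real T))
      \<le> real (card W) * (real s * real T) + real (card V) * real t"
    by (simp add: algebra_simps)
  \<comment> \<open>Half of the surplus pays for the error term with \<open>t\<close>; the other
    half remains as the lower bound on \<open>card W\<close>.\<close>
  moreover have "\<epsilon> * real T \<le> \<epsilon> * (real s * real T)"
  proof -
    have "0 \<le> \<epsilon> * real T" using tT by linarith
    then have "1 * (\<epsilon> * real T) \<le> real s * (\<epsilon> * real T)" using s by (intro mult_right_mono) auto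
    then show ?thesis by (simp add: mult_ac)
  qed
  then have "real (card V) * real t \<le> real (card V) * (\<epsilon> * (real s * real T) / 2)"
    using tT by (intro mult_left_mono) auto
  ultimately have "(\<epsilon> / 2 * real (card V)) * (real s * real T) \<le> real (card W) * (real s * real T)"
    by (simp add: field_simps)
  then have "\<epsilon> / 2 * real (card V) \<le> real (card W)" using s T by simp
  then show ?thesis by (simp add: W_def N_def)
qed

text \<open>Induction on the number \<open>s\<close> of parts, with \<open>r\<close> and hence the
  degree condition on \<open>V\<close> kept fixed. The size \<open>t\<close> must be arbitrary,
  because adding a part of size \<open>t\<close> starts from much larger parts of size
  \<open>T\<close>.\<close>

lemma Erdos_Stone_min_degree:
  fixes \<epsilon> :: real
  assumes "\<epsilon> > 0" and "s \<le> Suc r"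
  shows "\<exists>n\<^sub>0. \<forall>(D :: 'a set set) V. finite V \<longrightarrow> n\<^sub>0 \<le> card V \<longrightarrow>
    (\<forall>v\<in>V. (1 - 1 / real r + \<epsilon>) * real (card V) \<le> real (card {u \<in> V. {u, v} \<in> D})) \<longrightarrow>
    (\<exists>A. complete_multipartite D V s t A)"
  using assms(2)
proof (induction s arbitrary: t)
  case 0
  then show ?case by (simp add: complete_multipartite_def)
next
  case (Suc s)
  show ?case
  proof (cases "s = 0")
    \<comment> \<open>A single part is any \<open>t\<close>-subset of \<open>V\<close>. The counting
      argument starts only from at least one part.\<close>
    case True
    have "\<exists>A. complete_multipartite D V (Suc s) t A" if "finite V" and le: "t \<le> card V" for D V
    proof -
      obtain X where "X \<subseteq> V" "card X = t" "finite X"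
        using le by (rule obtain_subset_with_card_n)
      then show ?thesis
        using True by (intro exI[of _ "\<lambda>_. X"]) (simp add: complete_multipartite_def)
    qed
    then show ?thesis by blast
  next
    case False
    then have s: "s \<ge> 1" by simp
    \<comment> \<open>The quotient makes \<open>t\<close> at most \<open>\<epsilon> * T / 2\<close>,
      and \<open>Suc\<close> makes \<open>T\<close> positive.\<close>
    define T where "T = Suc (nat \<lceil>2 * real t / \<epsilon>\<rceil>)"
    have "2 * real t / \<epsilon> \<le> real T" unfolding T_def by linarith
    then have tT: "2 * real t \<le> \<epsilon> * real T" using assms(1) by (simp add: field_simps)
    obtain n1 where n1: "\<And>(D :: 'a set set) V. finite V \<Longrightarrow> n1 \<le> card V \<Longrightarrow>
        (\<forall>v\<in>V. (1 - 1 / real r + \<epsilon>) * real (card V) \<le> real (card {u \<in> V. {u, v} \<in> D})) \<Longrightarrow>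
        \<exists>A. complete_multipartite D V s T A"
      using Suc.IH[of T] Suc.prems by (auto simp: Suc_le_eq)
    \<comment> \<open>\<open>M\<close> is the size that \<open>W\<close> has to exceed for the
      pigeonhole step; \<open>n2\<close> is chosen so that \<open>\<epsilon> / 2 * card V\<close>
      exceeds \<open>M\<close>.\<close>
    define M where "M = (2 ^ T) ^ s * t"
    define n2 where "n2 = Suc (nat \<lceil>2 * real M / \<epsilon>\<rceil>)"
    have "\<exists>A. complete_multipartite D V (Suc s) t A"
      if fin: "finite V" and n: "max n1 n2 \<le> card V"
        and deg: "\<forall>v\<in>V. (1 - 1 / real r + \<epsilon>) * real (card V) \<le> real (card {u \<in> V. {u, v} \<in> D})"
      for D :: "'a set set" and V
    proof -
      obtain A where A: "complete_multipartite D V s T A" using n1[OF fin _ deg] n by auto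
      define W where "W = {v \<in> V. \<forall>i<s. t \<le> card {u \<in> A i. {u, v} \<in> D}}"
      \<comment> \<open>Since \<open>s\<close> is at most \<open>r\<close>, the degree condition for
        \<open>r\<close> implies the one for \<open>s\<close>.\<close>
      have "1 / real r \<le> 1 / real s" using Suc.prems s by (intro divide_left_mono) auto
      then have "(1 - 1 / real s + \<epsilon>) * real (card V) \<le> (1 - 1 / real r + \<epsilon>) * real (card V)"
        by (intro mult_right_mono) auto
      then have "(1 - 1 / real s + \<epsilon>) * real (card V) \<le> real (card {u \<in> V. {u, v} \<in> D})"
        if "v \<in> V" for v
        using deg that by (meson order_trans)
      then have W: "\<epsilon> / 2 * real (card V) \<le> real (card W)"
        unfolding W_def using many_common_neighbours[OF A fin s _ tT] by (simp add: T_def)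
      have "2 * real M / \<epsilon> < real n2" unfolding n2_def by linarith
      also have "\<dots> \<le> real (card V)" using n by simp
      finally have "real M < \<epsilon> / 2 * real (card V)" using assms(1) by (simp add: field_simps)
      with W have "M < card W" by linarith
      then show ?thesis
        using fin by (intro complete_multipartite_extend[OF A, of W]) (auto simp: W_def M_def)
    qed
    then show ?thesis by blast
  qed
qed

text \<open>Half of \<epsilon> is kept as the surplus in the minimum degree of a subset
  \<open>S\<close>. The other half forces \<open>S\<close> to contain enough edges, hence enough
  vertices, for the minimum degree version to apply to it.\<close>

theorem Erdos_Stone:
  fixes \<epsilon> :: real
  assumes "\<epsilon> > 0"
  shows "\<exists>n\<^sub>0. \<forall>(D :: 'a set set) V. finite V \<longrightarrow> n\<^sub>0 \<le> card V \<longrightarrow>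
    (\<forall>e\<in>D. card e = 2 \<and> e \<subseteq> V) \<longrightarrow>
    (1 - 1 / real r + \<epsilon>) * real (card V choose 2) < real (card D) \<longrightarrow>
    (\<exists>A. complete_multipartite D V (Suc r) t A)"
proof -
  define a where "a = 1 - 1 / real r + \<epsilon> / 2"
  \<comment> \<open>The case \<open>r = 0\<close> is covered because \<open>1 / 0 = 0\<close>.
    Nonnegativity of \<open>a\<close> later allows the term subtracted for \<open>S\<close> to be
    dropped.\<close>
  have "1 / real r \<le> 1" by (cases r) auto
  then have a0: "a \<ge> 0" using assms by (simp add: a_def)
  obtain m where m: "\<And>(D :: 'a set set) V. finite V \<Longrightarrow> m \<le> card V \<Longrightarrow>
      (\<forall>v\<in>V. a * real (card V) \<le> real (card {u \<in> V. {u, v} \<in> D})) \<Longrightarrow>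
      \<exists>A. complete_multipartite D V (Suc r) t A"
    using Erdos_Stone_min_degree[of "\<epsilon> / 2" "Suc r" r t] assms unfolding a_def by auto
  \<comment> \<open>Chosen so that \<open>\<epsilon> / 4 * (x - 1) - a\<close> is at least
    \<open>m\<close> squared for \<open>x = card V\<close>. The \<open>Suc\<close> accounts for
    \<open>x - 1\<close> and gives \<open>x\<close> at least 1.\<close>
  define n0 where "n0 = Suc (nat \<lceil>4 / \<epsilon> * (a + (real m)\<^sup>2)\<rceil>)"
  have "\<exists>A. complete_multipartite D V (Suc r) t A"
    if fin: "finite V" and n: "n0 \<le> card V" and D: "\<forall>e\<in>D. card e = 2 \<and> e \<subseteq> V"
      and big: "(1 - 1 / real r + \<epsilon>) * real (card V choose 2) < real (card D)"
    for D :: "'a set set" and V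
  proof -
    have D2: "\<And>e. e \<in> D \<Longrightarrow> card e = 2" using D by blast
    define x where "x = real (card V)"
    obtain S where S: "S \<subseteq> V"
        "\<And>v. v \<in> S \<Longrightarrow> a * real (card S) \<le> real (card {u \<in> S. {u, v} \<in> D})"
        "real (card {e \<in> D. e \<subseteq> V}) - a * (x * (x + 1) / 2)
          \<le> real (card {e \<in> D. e \<subseteq> S}) - a * (real (card S) * (real (card S) + 1) / 2)"
      using large_min_degree_subset[OF fin D2, of D a] unfolding x_def by blast
    have finS: "finite S" using S(1) fin finite_subset by auto
    have "real n0 \<le> x" using n by (simp add: x_def)
    then have "4 / \<epsilon> * (a + (real m)\<^sup>2) \<le> x - 1" and x1: "1 \<le> x"
      unfolding n0_def by linarith+
    then have "a + (real m)\<^sup>2 \<le> \<epsilon> / 4 * (x - 1)" using assms by (simp add: field_simps)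
    then have "1 * (real m)\<^sup>2 \<le> x * (\<epsilon> / 4 * (x - 1) - a)"
      using x1 by (intro mult_mono) auto
    \<comment> \<open>The quadratic terms differ by the factor \<open>\<epsilon> / 2\<close>;
      passing from \<open>x - 1\<close> to \<open>x + 1\<close> costs only the linear term
      \<open>a * x\<close>.\<close>
    also have "\<dots> = (1 - 1 / real r + \<epsilon>) * (x * (x - 1) / 2) - a * (x * (x + 1) / 2)"
      by (simp add: a_def algebra_simps add_divide_distrib diff_divide_distrib)
    also have "x * (x - 1) / 2 = real (card V choose 2)"
      using x1 by (simp add: choose_two real_of_nat_div x_def of_nat_diff)
    also have "(1 - 1 / real r + \<epsilon>) * real (card V choose 2) - a * (x * (x + 1) / 2)
        < real (card D) - a * (x * (x + 1) / 2)"
      using big by simp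
    also have "{e \<in> D. e \<subseteq> V} = D" using D by auto
    then have "real (card D) - a * (x * (x + 1) / 2)
        \<le> real (card {e \<in> D. e \<subseteq> S}) - a * (real (card S) * (real (card S) + 1) / 2)"
      using S(3) by simp
    also have "\<dots> \<le> real (card {e \<in> D. e \<subseteq> S})" using a0 by simp
    also have "\<dots> \<le> real ((card S)\<^sup>2)"
      using edges_within_le_square[OF finS D2] of_nat_mono by blast
    finally have "(real m)\<^sup>2 < (real (card S))\<^sup>2" by simp
    then have "m \<le> card S" using power2_less_imp_less[of "real m" "real (card S)"] by simp
    then obtain A where "complete_multipartite D S (Suc r) t A"
      using m[OF finS, of D] S(2) by blast
    then have "complete_multipartite D V (Suc r) t A"
      using S(1) by (simp add: complete_multipartite_def subset_trans[of _ S V])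
    then show ?thesis by blast
  qed
  then show ?thesis by blast
qed

section \<open>Berge copies in hypergraphs with a dense shadow\<close>

text \<open>A union bound over the coordinates. The set forbidden at \<open>i\<close> depends only
  on the other coordinates, so a map that is bad at \<open>i\<close> is given by its restriction and
  one of at most \<open>K\<close> values. Altogether at most
  \<open>card I * K * T ^ (card I - 1)\<close> maps are bad, fewer than the
  \<open>T ^ card I\<close> available ones.\<close>

lemma PiE_avoiding_choice:
  fixes A :: "'b \<Rightarrow> 'c set" and X :: "'b \<Rightarrow> ('b \<Rightarrow> 'c) \<Rightarrow> 'c set"
  assumes I: "finite I" and A: "\<And>i. i \<in> I \<Longrightarrow> finite (A i) \<and> card (A i) = T"
    and X: "\<And>i \<phi>. i \<in> I \<Longrightarrow> finite (X i \<phi>) \<and> card (X i \<phi>) \<le> K"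
    and T: "card I * K < T"
  shows "\<exists>\<phi>\<in>Pi\<^sub>E I A. \<forall>i\<in>I. \<phi> i \<notin> X i (restrict \<phi> (I - {i}))"
proof (rule ccontr)
  assume contr: "\<not> ?thesis"
  define bad where "bad i = {\<phi> \<in> Pi\<^sub>E I A. \<phi> i \<in> X i (restrict \<phi> (I - {i}))}" for i
  have "card (bad i) \<le> T ^ (card I - 1) * K" if i: "i \<in> I" for i
  proof -
    let ?P = "Pi\<^sub>E (I - {i}) A"
    have finP: "finite ?P" using I A by (intro finite_PiE) auto
    have cP: "card ?P = T ^ (card I - 1)" using I A i by (simp add: card_PiE)
    have "bad i \<subseteq> (\<lambda>(\<psi>, x). \<psi>(i := x)) ` Sigma ?P (X i)"
    proof
      fix \<phi> assume \<phi>: "\<phi> \<in> bad i"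
      then have "\<phi> = (restrict \<phi> (I - {i}))(i := \<phi> i)"
        using i by (auto simp: bad_def fun_eq_iff PiE_def extensional_def)
      moreover have "(restrict \<phi> (I - {i}), \<phi> i) \<in> Sigma ?P (X i)"
        using \<phi> by (auto simp: bad_def)
      ultimately show "\<phi> \<in> (\<lambda>(\<psi>, x). \<psi>(i := x)) ` Sigma ?P (X i)"
        by (metis (no_types, lifting) case_prod_conv image_eqI)
    qed
    moreover have finS: "finite (Sigma ?P (X i))" using finP X[OF i] by auto
    ultimately have "card (bad i) \<le> card (Sigma ?P (X i))"
      by (meson card_image_le card_mono finite_imageI order_trans)
    also have "\<dots> = (\<Sum>\<psi>\<in>?P. card (X i \<psi>))" using finP X[OF i] by simp
    also have "\<dots> \<le> card ?P * K" using sum_bounded_above[of ?P _ K] X[OF i] by simp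
    finally show ?thesis by (simp add: cP)
  qed
  then have "(\<Sum>i\<in>I. card (bad i)) \<le> card I * (T ^ (card I - 1) * K)"
    using sum_bounded_above[of I "\<lambda>i. card (bad i)"] by simp
  moreover have "Pi\<^sub>E I A = (\<Union>i\<in>I. bad i)" using contr by (auto simp: bad_def)
  then have "card (Pi\<^sub>E I A) \<le> (\<Sum>i\<in>I. card (bad i))" using card_UN_le[OF I, of bad] by simp
  moreover have "card (Pi\<^sub>E I A) = T ^ card I" using I A by (simp add: card_PiE)
  ultimately have le: "T ^ card I \<le> card I * K * T ^ (card I - 1)" by (simp add: mult_ac)
  show False
  \<comment> \<open>For empty \<open>I\<close> the exponent \<open>card I - 1\<close> is truncated.
    The product then has one element while the bound is 0.\<close>
  proof (cases "card I")
    case 0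
    with le show False by simp
  next
    case (Suc m)
    have "card I * K * T ^ m < T * T ^ m" using T by (intro mult_strict_right_mono) auto
    with le Suc show False by simp
  qed
qed

section \<open>Edges and colourings of simple graphs\<close>

lemma simple_graph_edge_ends:
  assumes "simple_graph G" and "e \<in> edges G"
  obtains u v where "e = {u, v}" and "u \<noteq> v" and "u \<in> verts G" and "v \<in> verts G"
proof -
  have "card e = 2" "e \<subseteq> verts G" using assms by (auto simp: k_graph_def is_hypergraph_def)
  then show ?thesis using that by (auto simp: card_2_iff)
qed

text \<open>The least number of colours is attained once some proper colouring exists; numbering the
  finitely many vertices injectively gives one, since there are no loops.\<close>

lemma chromatic_number_coloring:
  assumes "simple_graph G"
  obtains col where "proper_coloring G (chromatic_number G) col"
proof -
  have "finite (verts G)" using assms by (simp add: k_graph_def is_hypergraph_def)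
  then obtain h :: "'a \<Rightarrow> nat" where h: "bij_betw h (verts G) {..<card (verts G)}"
    using ex_bij_betw_finite_nat atLeast0LessThan by metis
  have "h u \<noteq> h v" if "{u, v} \<in> edges G" for u v
  proof -
    from simple_graph_edge_ends[OF assms that] have "u \<noteq> v" "u \<in> verts G" "v \<in> verts G"
      by (auto simp: doubleton_eq_iff)
    then show ?thesis using h by (auto simp: bij_betw_def inj_on_def)
  qed
  then have "proper_coloring G (card (verts G)) h"
    using h by (auto simp: proper_coloring_def bij_betw_def)
  then have "\<exists>col. proper_coloring G (chromatic_number G) col"
    unfolding chromatic_number_def by (rule LeastI[of "\<lambda>c. \<exists>col. proper_coloring G c col", OF exI])
  then show ?thesis using that by blast
qed

text \<open>Colour class \<open>i\<close> is mapped into the part \<open>A i\<close>, so edges of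
  \<open>G\<close> become shadow edges. The threshold on \<open>T\<close> counts the values
  forbidden at a vertex: at most \<open>card (verts G)\<close> other images, and \<open>k\<close>
  vertices for each assigned hyperedge.\<close>

lemma Berge_in_multipartite_shadow:
  fixes G :: "'a hypergraph" and H :: "'b hypergraph"
  assumes G: "simple_graph G" and H: "k_graph k H" and col: "proper_coloring G r col"
    and A: "complete_multipartite (edges (shadow H)) (verts H) r T A"
    and T: "card (verts G) * (card (verts G) + card (edges G) * k) < T" and k: "k \<noteq> 0"
  shows "\<not> Berge_free G H"
proof -
  have finV: "finite (verts G)" and eV: "\<And>e. e \<in> edges G \<Longrightarrow> e \<subseteq> verts G"
    and e2: "\<And>e. e \<in> edges G \<Longrightarrow> card e = 2"
    using G by (auto simp: k_graph_def is_hypergraph_def)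
  have "edges G \<subseteq> Pow (verts G)" using eV by blast
  then have finE: "finite (edges G)" using finV by (simp add: finite_subset)
  have "\<exists>h. h \<in> edges H \<and> d \<subseteq> h" if "d \<in> edges (shadow H)" for d
    using that by (auto simp: shadow_def)
  then obtain F where F: "\<And>d. d \<in> edges (shadow H) \<Longrightarrow> F d \<in> edges H \<and> d \<subseteq> F d" by metis
  \<comment> \<open>The avoidance lemma asks for a size bound for every map, including maps that do
    not send edges of \<open>G\<close> to shadow edges. The default \<open>{}\<close> keeps the
    bound \<open>k\<close> there.\<close>
  define F' where "F' d = (if d \<in> edges (shadow H) then F d else {})" for d
  have F': "finite (F' d) \<and> card (F' d) \<le> k" for d
  proof (cases "d \<in> edges (shadow H)")
    case True
    then have "card (F d) = k" using F H by (auto simp: k_graph_def)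
    with k True show ?thesis by (auto simp: F'_def intro: card_ge_0_finite)
  qed (simp add: F'_def)
  define X where "X w \<phi> = \<phi> ` (verts G - {w}) \<union> (\<Union>e\<in>{e \<in> edges G. w \<notin> e}. F' (\<phi> ` e))"
    for w and \<phi> :: "'a \<Rightarrow> 'b"
  have X: "finite (X w \<phi>) \<and> card (X w \<phi>) \<le> card (verts G) + card (edges G) * k"
    if "w \<in> verts G" for w \<phi>
  proof
    show "finite (X w \<phi>)" unfolding X_def using finV finE F' by auto
    have "card (\<phi> ` (verts G - {w})) \<le> card (verts G)"
      using finV by (meson card_image_le card_mono finite_Diff Diff_subset order_trans)
    moreover have "card (\<Union>e\<in>{e \<in> edges G. w \<notin> e}. F' (\<phi> ` e)) \<le> card (edges G) * k"
    proof -
      have "card (\<Union>e\<in>{e \<in> edges G. w \<notin> e}. F' (\<phi> ` e))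
          \<le> (\<Sum>e\<in>{e \<in> edges G. w \<notin> e}. card (F' (\<phi> ` e)))"
        using finE by (intro card_UN_le) auto
      also have "\<dots> \<le> card {e \<in> edges G. w \<notin> e} * k"
        using sum_bounded_above[of "{e \<in> edges G. w \<notin> e}" "\<lambda>e. card (F' (\<phi> ` e))" k] F' by simp
      also have "\<dots> \<le> card (edges G) * k" using finE by (intro mult_right_mono card_mono) auto
      finally show ?thesis .
    qed
    ultimately show "card (X w \<phi>) \<le> card (verts G) + card (edges G) * k"
      unfolding X_def using card_Un_le[of "\<phi> ` (verts G - {w})"] by (meson add_mono order_trans)
  qed
  have colr: "col v < r" if "v \<in> verts G" for v
    using col that by (auto simp: proper_coloring_def)
  have partA: "finite (A (col v)) \<and> card (A (col v)) = T" "A (col v) \<subseteq> verts H"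
    if "v \<in> verts G" for v
    using A colr[OF that] by (auto simp: complete_multipartite_def)
  obtain \<phi> where \<phi>: "\<phi> \<in> (\<Pi>\<^sub>E v\<in>verts G. A (col v))"
      and av: "\<And>w. w \<in> verts G \<Longrightarrow> \<phi> w \<notin> X w (restrict \<phi> (verts G - {w}))"
    using PiE_avoiding_choice[where A = "\<lambda>v. A (col v)" and X = X, OF finV partA(1) X T] by blast
  have \<phi>A: "\<phi> v \<in> A (col v)" if "v \<in> verts G" for v using \<phi> that by auto
  have inj: "inj_on \<phi> (verts G)"
  proof (rule inj_onI, rule ccontr)
    fix u v assume uv: "u \<in> verts G" "v \<in> verts G" "\<phi> u = \<phi> v" "u \<noteq> v"
    then have "\<phi> u \<in> X u (restrict \<phi> (verts G - {u}))" unfolding X_def by auto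
    with av uv show False by blast
  qed
  have sh: "\<phi> ` e \<in> edges (shadow H)" if e: "e \<in> edges G" for e
  proof -
    obtain u v where uv: "e = {u, v}" "u \<in> verts G" "v \<in> verts G"
      using simple_graph_edge_ends[OF G e] by blast
    then have "col u \<noteq> col v" using col e by (auto simp: proper_coloring_def)
    then have "{\<phi> u, \<phi> v} \<in> edges (shadow H)"
      using A colr[OF uv(2)] colr[OF uv(3)] \<phi>A[OF uv(2)] \<phi>A[OF uv(3)]
      by (simp add: complete_multipartite_def)
    then show ?thesis using uv by simp
  qed
  define f where "f e = F (\<phi> ` e)" for e
  have f: "f e \<in> edges H" "\<phi> ` e \<subseteq> f e" if "e \<in> edges G" for e
    using F[OF sh[OF that]] by (auto simp: f_def)
  have injf: "inj_on f (edges G)"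
  proof (rule inj_onI, rule ccontr)
    fix e e' assume e: "e \<in> edges G" "e' \<in> edges G" "f e = f e'" "e \<noteq> e'"
    \<comment> \<open>Two distinct sets of the same finite size cannot be nested, which yields the
      vertex \<open>w\<close> at which avoidance is applied.\<close>
    have "\<not> e' \<subseteq> e"
      using e e2 card_subset_eq[of e e'] by (metis card.infinite zero_neq_numeral)
    then obtain w where w: "w \<in> e'" "w \<notin> e" by blast
    then have wV: "w \<in> verts G" using eV e by auto
    \<comment> \<open>As \<open>e\<close> misses \<open>w\<close>, forgetting the value at
      \<open>w\<close> leaves the image of \<open>e\<close> unchanged, so the hyperedge of
      \<open>e\<close> is among the sets forbidden at \<open>w\<close>.\<close>
    have "e \<subseteq> verts G - {w}" using eV e w by auto
    then have "restrict \<phi> (verts G - {w}) ` e = \<phi> ` e" by (intro image_cong) auto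
    then have "f e = F' (restrict \<phi> (verts G - {w}) ` e)"
      using sh[OF e(1)] by (simp add: f_def F'_def)
    then have "f e \<subseteq> X w (restrict \<phi> (verts G - {w}))"
      unfolding X_def using e(1) w(2) by blast
    then show False using av[OF wV] f(2)[OF e(2)] e(3) w(1) by auto
  qed
  \<comment> \<open>Only the chosen hyperedges are kept, so the injective \<open>f\<close> becomes a
    bijection onto the edges.\<close>
  define H' where "H' = \<lparr>verts = verts H, edges = f ` edges G\<rparr>"
  have "subhypergraph H' H"
    using H f(1) by (auto simp: subhypergraph_def H'_def k_graph_def is_hypergraph_def)
  moreover have "is_Berge G H'"
    unfolding is_Berge_def
  proof (intro exI conjI allI impI)
    show "inj_on \<phi> (verts G)" by (rule inj)
    show "\<phi> ` verts G \<subseteq> verts H'" using \<phi>A partA(2) by (auto simp: H'_def)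
    show "bij_betw f (edges G) (edges H')" using injf by (simp add: bij_betw_def H'_def)
    show "{\<phi> u, \<phi> v} \<subseteq> f {u, v}" if "{u, v} \<in> edges G" for u v using f(2)[OF that] by simp
  qed
  ultimately show ?thesis by (auto simp: Berge_free_def)
qed

section \<open>The bound for shadows of Berge-free hypergraphs\<close>

theorem theorem1:
  fixes k :: nat and G :: "'a hypergraph" and \<epsilon> :: real
  assumes "k \<ge> 2"
    and "simple_graph G"
    and "chromatic_number G \<ge> 2"
    and "\<epsilon> > 0"
  shows "\<exists>n\<^sub>0. \<forall>n\<ge>n\<^sub>0.
    real (ex_hat k n G) \<le>
      (1 - 1 / (real (chromatic_number G) - 1) + \<epsilon>) * real (n choose 2)"
proof -
  \<comment> \<open>With this \<open>r\<close>, the density \<open>1 - 1 / r\<close> forces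
    \<open>Suc r\<close> parts, exactly one for each colour.\<close>
  define r where "r = chromatic_number G - 1"
  have r: "chromatic_number G = Suc r" using assms(3) by (simp add: r_def)
  obtain col where col: "proper_coloring G (Suc r) col"
    using chromatic_number_coloring[OF assms(2)] r by metis
  define T where "T = Suc (card (verts G) * (card (verts G) + card (edges G) * k))"
  obtain n0 where n0: "\<And>(D :: nat set set) V. finite V \<Longrightarrow> n0 \<le> card V \<Longrightarrow>
      \<forall>e\<in>D. card e = 2 \<and> e \<subseteq> V \<Longrightarrow>
      (1 - 1 / real r + \<epsilon>) * real (card V choose 2) < real (card D) \<Longrightarrow>
      \<exists>A. complete_multipartite D V (Suc r) T A"
    using Erdos_Stone[OF assms(4), of r T] by blast
  have "real (ex_hat k n G) \<le> (1 - 1 / real r + \<epsilon>) * real (n choose 2)" if n: "n0 \<le> n" for n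
  proof (rule ccontr)
    assume big: "\<not> ?thesis"
    \<comment> \<open>The maximum is attained, so exceeding the bound yields one Berge-free
      \<open>H\<close> whose shadow is too dense.\<close>
    have "ex_hat k n G \<in> shadow_sizes k n G"
      unfolding ex_hat_def
      by (intro Max_in finite_shadow_sizes shadow_sizes_nonempty
          chromatic_number_ge_2_imp_edges[OF assms(3)])
    then obtain H :: "nat hypergraph" where H: "ex_hat k n G = card (edges (shadow H))"
        "k_graph k H" "card (verts H) = n" "Berge_free G H"
      by (auto simp: shadow_sizes_def)
    have sub: "\<forall>h\<in>edges H. h \<subseteq> verts H" "finite (verts H)"
      using H(2) by (auto simp: k_graph_def is_hypergraph_def)
    have "\<forall>e\<in>edges (shadow H). card e = 2 \<and> e \<subseteq> verts H"
      using sub(1) by (fastforce simp: shadow_def)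
    then obtain A where "complete_multipartite (edges (shadow H)) (verts H) (Suc r) T A"
      using n0[of "verts H" "edges (shadow H)"] sub(2) n big H by auto
    then have "\<not> Berge_free G H"
      using assms(1) by (intro Berge_in_multipartite_shadow[OF assms(2) H(2) col]) (auto simp: T_def)
    with H(4) show False by blast
  qed
  then show ?thesis using r by auto
qed

end
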